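(* Let $n\ge 2$ be an integer. Then the following are equivalent: (A) for every $z\in\mathbb{Z}_n$, the congruence $x^2+y^2\equiv z \pmod n$ has a nontrivial solution; (B) all of the following conditions hold: (1) $n\not\equiv 0 \pmod{q^2}$ for any prime $q\equiv 3\pmod 4$ with $n\equiv 0\pmod q$; (2) $n\not\equiv 0\pmod 4$; (3) $n\equiv 0\pmod p$ for some prime $p\equiv 1\pmod 4$; (4) if $n\equiv 1\pmod 2$ and one writes $n=5^k m$ with $k\ge 0$ and $m\not\equiv 0\pmod 5$, then either (a) $k\ge 3$ (with no further restrictions on $m$), or (b) $k<3$ and $m\equiv 0\pmod p$ for some prime $p\equiv 1\pmod 4$.
   Context: $\mathbb{Z}_n$ denotes the ring of integers modulo $n$. For a given $z\in\mathbb{Z}_n$, a nontrivial solution to $x^2+y^2\equiv z\pmod n$ is a pair of squares $(x^2,y^2)$, with $x,y$ integers, satisfying this congruence and such that $x^2\not\equiv 0\pmod n$ and $y^2\not\equiv 0\pmod n$ (note that it is the squares $x^2,y^2$, not merely $x,y$, that must be nonzero modulo $n$). *)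

theory Defs
  imports "HOL-Number_Theory.Number_Theory"
begin

(* A nontrivial solution is the pair of squares (a, b) = (x^2, y^2), not the pair (x, y);
   it is the squares a and b that must be nonzero modulo n. *)
definition nontrivial_solution :: "int \<Rightarrow> int \<Rightarrow> int \<times> int \<Rightarrow> bool" where
  "nontrivial_solution n z s \<longleftrightarrow>
     (\<exists>x y :: int. s = (x\<^sup>2, y\<^sup>2) \<and> [x\<^sup>2 + y\<^sup>2 = z] (mod n)
        \<and> \<not> [x\<^sup>2 = 0] (mod n) \<and> \<not> [y\<^sup>2 = 0] (mod n))"

end

theory Submission
  imports Defs
begin

text \<open>
  Necessity comes from single residues \<open>z\<close> and the fact that a prime \<open>q \<equiv> 3 (mod 4)\<close> dividing
  \<open>x\<^sup>2 + y\<^sup>2\<close> divides both \<open>x\<close> and \<open>y\<close>. In the absence of primes \<open>1 (mod 4)\<close> one takes \<open>z\<close> to be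
  the odd part of \<open>n\<close>; for odd \<open>n = 5\<^sup>k m\<close> one takes \<open>z \<equiv> 0 (mod m)\<close> and \<open>z \<equiv> 1 (mod 5)\<close>, since
  \<open>1\<close> is not a sum of two nonzero squares modulo \<open>5\<close>.

  For sufficiency, fix a prime \<open>p \<equiv> 1 (mod 4)\<close> dividing \<open>n\<close>. Modulo \<open>p\<^sup>k\<close> there is \<open>i\<close> with
  \<open>i\<^sup>2 = -1\<close>, so that \<open>x\<^sup>2 + y\<^sup>2\<close> factors and all its representations of \<open>z\<close> can be written down;
  one of them has both squares nonzero. The Chinese remainder theorem combines it with an arbitrary
  representation of \<open>z\<close> modulo the rest of \<open>n\<close>.
\<close>

section \<open>The quadratic character of -1 and prime divisors of sums of two squares\<close>

lemma prime_int_cong_1_or_3: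
  fixes p :: int
  assumes "prime p" "p \<noteq> 2"
  shows "[p = 1] (mod 4) \<or> [p = 3] (mod 4)"
proof -
  have "odd p"
    using assms by (metis prime_odd_int prime_gt_1_int order_le_less zless_imp_add1_zle one_add_one)
  then show ?thesis
    unfolding cong_def by presburger
qed

lemma QuadRes_minus_one_iff:
  fixes p :: int
  assumes "prime p" "p \<noteq> 2"
  shows "QuadRes p (-1) \<longleftrightarrow> [p = 1] (mod 4)"
proof -
  obtain k where k: "p = int k" "prime k"
    using assms(1) by (metis prime_int_nat_transfer int_nat_eq)
  then have k2: "2 < k"
    using assms(2) prime_ge_2_nat[of k] by auto
  have "[Legendre (-1) (int k) = (-1) ^ ((k - 1) div 2)] (mod int k)"
    using euler_criterion[OF k(2) k2] .
  \<comment> \<open>As \<open>k > 2\<close>, the values 0, 1 and -1 are distinct modulo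
    \<open>k\<close>, so the congruence determines the Legendre symbol.\<close>
  moreover have "\<not> int k dvd 1" "\<not> int k dvd 2"
    using k2 by (auto dest!: zdvd_imp_le)
  ultimately have "QuadRes (int k) (-1) \<longleftrightarrow> even ((k - 1) div 2)"
    by (cases "even ((k - 1) div 2)")
      (auto simp: Legendre_def cong_iff_dvd_diff split: if_splits)
  also have "odd k"
    using k(2) k2 prime_odd_nat by blast
  then have "even ((k - 1) div 2) \<longleftrightarrow> int k mod 4 = 1"
    by presburger
  finally show ?thesis
    by (simp add: k(1) cong_def)
qed

lemma sqrt_minus_one_mod_prime:
  fixes p :: int
  assumes "prime p" "[p = 1] (mod 4)"
  obtains i where "p dvd i\<^sup>2 + 1"
proof -
  have "p \<noteq> 2"
    using assms(2) by (auto simp: cong_def)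
  then have "QuadRes p (-1)"
    using QuadRes_minus_one_iff assms by blast
  then show ?thesis
    using that by (auto simp: QuadRes_def cong_iff_dvd_diff)
qed

text \<open>If \<open>x\<close> had an inverse \<open>t\<close> modulo \<open>q\<close>, then
  \<open>y * t\<close> would be a square root of -1, which a prime 3 (mod 4) does not admit.\<close>

lemma prime_dvd_of_dvd_sum_squares:
  fixes q x y :: int
  assumes "prime q" "[q = 3] (mod 4)" "q dvd x\<^sup>2 + y\<^sup>2"
  shows "q dvd x"
proof (rule ccontr)
  assume "\<not> q dvd x"
  then have "coprime x q"
    using assms(1) prime_imp_coprime coprime_commute by blast
  then obtain t where "[x * t = 1] (mod q)"
    using cong_solve_coprime_int by blast
  then obtain a where a: "x * t = 1 + q * a"
    by (metis cong_iff_lin cong_sym)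
  obtain b where b: "x\<^sup>2 + y\<^sup>2 = q * b"
    using assms(3) by blast
  have "(y * t)\<^sup>2 + 1 = (x\<^sup>2 + y\<^sup>2) * t\<^sup>2 - ((x * t)\<^sup>2 - 1)"
    by (simp add: algebra_simps power2_eq_square)
  also have "\<dots> = q * (b * t\<^sup>2 - a * (2 + q * a))"
    unfolding a b by (simp add: algebra_simps power2_eq_square)
  finally have "q dvd (y * t)\<^sup>2 + 1"
    by simp
  then have "QuadRes q (-1)"
    by (auto simp: QuadRes_def cong_iff_dvd_diff)
  moreover have "q \<noteq> 2" "\<not> [q = 1] (mod 4)"
    using assms(2) by (auto simp: cong_def)
  ultimately show False
    using QuadRes_minus_one_iff assms(1) by blast
qed

text \<open>Each prime factor of \<open>d\<close> occurs in \<open>d\<close> exactly once and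
  divides \<open>x\<close>, so comparing multiplicities suffices.\<close>

lemma dvd_of_dvd_sum_squares:
  fixes d x y :: int
  assumes "d \<noteq> 0" "d dvd x\<^sup>2 + y\<^sup>2"
    and d: "\<And>q. prime q \<Longrightarrow> q dvd d \<Longrightarrow> [q = 3] (mod 4) \<and> \<not> q\<^sup>2 dvd d"
  shows "d dvd x"
\<comment> \<open>\<open>multiplicity q 0\<close> is 0 by convention, so \<open>x = 0\<close> is
  split off before multiplicities are compared.\<close>
proof (cases "x = 0")
  case False
  show ?thesis
  proof (rule multiplicity_le_imp_dvd[OF \<open>d \<noteq> 0\<close>])
    fix q :: int
    assume q: "prime q"
    show "multiplicity q d \<le> multiplicity q x"
    proof (cases "q dvd d")
      case True
      then have "multiplicity q d < 2"
        using d[OF q True] q \<open>d \<noteq> 0\<close> not_prime_unit by (metis multiplicity_lessI)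
      moreover have "q dvd x"
        using prime_dvd_of_dvd_sum_squares[OF q] d[OF q True] True assms(2) dvd_trans by blast
      then have "multiplicity q x > 0"
        using q False by (metis multiplicity_gt_zero_iff not_prime_unit)
      ultimately show ?thesis
        by simp
    qed (simp add: not_dvd_imp_multiplicity_0)
  qed
qed simp

section \<open>Representations in the presence of a square root of -1\<close>

text \<open>Hensel lifting: \<open>2 * i\<close> is a unit modulo \<open>p\<close>, so a root modulo
  \<open>p ^ k\<close> can be corrected to one modulo \<open>p ^ Suc k\<close>.\<close>

lemma sqrt_minus_one_mod_prime_power:
  fixes p :: int
  assumes "prime p" "[p = 1] (mod 4)"
  shows "\<exists>i. p ^ k dvd i\<^sup>2 + 1"
proof (induction k)
  case (Suc k)
  show ?case
  \<comment> \<open>Lifting uses that \<open>p ^ Suc k\<close> divides \<open>(p ^ k)^2\<close>,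
    which needs \<open>k > 0\<close>; the exponent 1 is therefore a second base case.\<close>
  proof (cases k)
    case 0
    then show ?thesis
      using sqrt_minus_one_mod_prime[OF assms] by (metis power_one_right One_nat_def)
  next
    case (Suc l)
    obtain i a where i: "i\<^sup>2 + 1 = p ^ k * a"
      using Suc.IH by blast
    have "p > 1" "p mod 4 = 1"
      using assms by (auto simp: prime_gt_1_int cong_def)
    then have "\<not> p dvd 2"
      by (auto dest!: zdvd_imp_le)
    moreover have "\<not> p dvd i"
    proof
      assume "p dvd i"
      then have "p dvd i\<^sup>2"
        by (simp add: power2_eq_square)
      moreover have "p dvd i\<^sup>2 + 1"
        unfolding i Suc by simp
      ultimately have "p dvd 1"
        by (metis dvd_add_right_iff)
      then show False
        using \<open>p > 1\<close> by simp
    qed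
    ultimately have "coprime (2 * i) p"
      using assms(1) prime_imp_coprime coprime_commute by (metis prime_dvd_mult_iff)
    then obtain t b where t: "2 * i * t = 1 + p * b"
      using cong_solve_coprime_int by (metis cong_iff_lin cong_sym)
    \<comment> \<open>Newton step \<open>i - (i^2 + 1) / (2 * i)\<close>, where \<open>t\<close>
      replaces the inverse of \<open>2 * i\<close>.\<close>
    have "(i - p ^ k * (a * t))\<^sup>2 + 1
        = (i\<^sup>2 + 1) - p ^ k * a * (2 * i * t) + (p ^ k)\<^sup>2 * (a * t)\<^sup>2"
      by (simp add: algebra_simps power2_eq_square)
    also have "\<dots> = p ^ k * (p * (- a * b)) + (p ^ k)\<^sup>2 * (a * t)\<^sup>2"
      unfolding i t by (simp add: algebra_simps power2_eq_square)
    also have "\<dots> = p ^ Suc k * (- a * b + p ^ l * (a * t)\<^sup>2)"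
      by (simp add: Suc algebra_simps power2_eq_square)
    finally show ?thesis
      by (metis dvd_triv_left)
  qed
qed simp

text \<open>
  With \<open>v = z / u\<close>, the factorisation \<open>z = u v = ((u + v) / 2)\<^sup>2 + (i (u - v) / 2)\<^sup>2\<close> is multiplied
  out so that no division occurs.
\<close>

lemma sum_two_squares_via_sqrt_minus_one:
  fixes M u z i :: int
  assumes "M dvd i\<^sup>2 + 1" "odd M" "coprime u M"
  obtains x y where "M dvd x\<^sup>2 + y\<^sup>2 - z" "M dvd 2 * u * x - (u\<^sup>2 + z)"
    "M dvd 2 * u * y - i * (u\<^sup>2 - z)"
proof -
  have "coprime (2 * u) M"
    using assms by simp
  then obtain t b where t: "2 * u * t = 1 + M * b"
    using cong_solve_coprime_int by (metis cong_iff_lin cong_sym)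
  obtain a where a: "i\<^sup>2 + 1 = M * a"
    using assms(1) by blast
  \<comment> \<open>With \<open>t\<close> as the inverse of \<open>2 * u\<close>, these are
    \<open>(u + v) / 2\<close> and \<open>i * (u - v) / 2\<close>. The identity below rests on
    \<open>(u^2 + z)^2 - (u^2 - z)^2 = 4 * u^2 * z\<close>.\<close>
  let ?x = "t * (u\<^sup>2 + z)" and ?y = "t * (i * (u\<^sup>2 - z))"
  have "?x\<^sup>2 + ?y\<^sup>2 - z = z * ((2 * u * t)\<^sup>2 - 1) + (i\<^sup>2 + 1) * (t\<^sup>2 * (u\<^sup>2 - z)\<^sup>2)"
    by (simp add: algebra_simps power2_eq_square)
  also have "\<dots> = M * (z * b * (2 + M * b) + a * (t\<^sup>2 * (u\<^sup>2 - z)\<^sup>2))"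
    unfolding t a by (simp add: algebra_simps power2_eq_square)
  finally have "M dvd ?x\<^sup>2 + ?y\<^sup>2 - z"
    by simp
  moreover have "2 * u * ?x - (u\<^sup>2 + z) = (2 * u * t - 1) * (u\<^sup>2 + z)"
    by (simp add: algebra_simps power2_eq_square)
  then have "M dvd 2 * u * ?x - (u\<^sup>2 + z)"
    unfolding t by simp
  moreover have "2 * u * ?y - i * (u\<^sup>2 - z) = (2 * u * t - 1) * (i * (u\<^sup>2 - z))"
    by (simp add: algebra_simps power2_eq_square)
  then have "M dvd 2 * u * ?y - i * (u\<^sup>2 - z)"
    unfolding t by simp
  ultimately show thesis
    by (rule that)
qed

lemma coprime_of_dvd_square_plus_one:
  fixes M i :: int
  assumes "M dvd i\<^sup>2 + 1"
  shows "coprime M i"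
proof (rule coprimeI)
  fix c
  assume "c dvd M" "c dvd i"
  then have "c dvd i\<^sup>2 + 1" "c dvd i\<^sup>2"
    using assms by (auto simp: power2_eq_square intro: dvd_trans)
  then show "is_unit c"
    by (metis dvd_add_right_iff)
qed

text \<open>For \<open>u = 1\<close>, if \<open>w\<close> divided both coordinates it would divide
  \<open>1 + z\<close> and \<open>1 - z\<close>, hence 2, although it is odd and not a unit. By
  symmetry the coordinate that escapes can be put second.\<close>

lemma sum_two_squares_second_nonzero:
  fixes M w z i :: int
  assumes M: "M dvd i\<^sup>2 + 1" "odd M" and w: "w dvd M" "\<not> is_unit w"
  obtains x y where "M dvd x\<^sup>2 + y\<^sup>2 - z" "\<not> w dvd y"
proof -
  obtain x y where xy: "M dvd x\<^sup>2 + y\<^sup>2 - z" "M dvd 2 * 1 * x - (1\<^sup>2 + z)"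
    "M dvd 2 * 1 * y - i * (1\<^sup>2 - z)"
    using sum_two_squares_via_sqrt_minus_one[OF M, of 1 z] by auto
  have "\<not> w dvd x \<or> \<not> w dvd y"
  proof (rule ccontr)
    assume "\<not> ?thesis"
    then have "w dvd 2 * 1 * x" "w dvd 2 * 1 * y"
      by auto
    then have "w dvd 1\<^sup>2 + z" "w dvd i * (1\<^sup>2 - z)"
      using xy(2,3) w(1) by (meson dvd_trans dvd_diff_right_iff)+
    moreover have "coprime w i"
      using coprime_divisors[OF w(1) dvd_refl] coprime_of_dvd_square_plus_one[OF M(1)] by blast
    ultimately have "w dvd 1\<^sup>2 + z" "w dvd 1\<^sup>2 - z"
      by (simp_all add: coprime_dvd_mult_right_iff)
    then have "w dvd (1\<^sup>2 + z) + (1\<^sup>2 - z)"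
      by (rule dvd_add)
    then have "w dvd 2"
      by simp
    moreover have "coprime w 2"
      using M(2) w(1) by (auto intro: dvd_trans)
    ultimately show False
      using w(2) by (metis coprime_absorb_left)
  qed
  then show thesis
    using that[of x y] that[of y x] xy(1) by (auto simp: add.commute)
qed

text \<open>
  The parameter \<open>u\<close> has to avoid \<open>u\<^sup>2 \<equiv> \<plusminus>z\<close> modulo \<open>w\<close>. If each of \<open>1, 2, 3\<close> failed, two of
  the squares \<open>1, 4, 9\<close> would agree modulo \<open>w\<close>, so \<open>w\<close> would divide \<open>3\<close>, \<open>5\<close> or \<open>8\<close>.
\<close>

lemma sum_two_squares_both_nonzero:
  fixes M w z i :: int
  assumes M: "M dvd i\<^sup>2 + 1" "odd M" "\<not> 3 dvd M" and w: "w dvd M" "\<not> w dvd 5"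
  obtains x y where "M dvd x\<^sup>2 + y\<^sup>2 - z" "\<not> w dvd x" "\<not> w dvd y"
proof -
  have "prime (3::int)" by simp
  then have c3: "coprime 3 M"
    using M(3) prime_imp_coprime by blast
  have c2: "coprime 2 M"
    using M(2) by simp
  have nu: "\<not> is_unit w"
    using w(2) by (meson dvd_trans one_dvd)
  have w3: "\<not> w dvd 3"
    using c3 w(1) nu by (meson coprime_common_divisor)
  have "coprime ((2::int) ^ 3) M"
    using c2 by (subst coprime_power_left_iff) simp
  then have w8: "\<not> w dvd 8"
    using w(1) nu by (auto dest: coprime_common_divisor)
  have "\<exists>u\<in>{1,2,3}. \<not> w dvd u\<^sup>2 + z \<and> \<not> w dvd u\<^sup>2 - z"
  proof (rule ccontr)
    assume "\<not> ?thesis"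
    then have "w dvd 1 + z \<or> w dvd 1 - z" "w dvd 4 + z \<or> w dvd 4 - z" "w dvd 9 + z \<or> w dvd 9 - z"
      by auto
    \<comment> \<open>Three failures share two signs, so two have the same sign, and
      \<open>z\<close> cancels in their difference.\<close>
    then have "w dvd (4 + z) - (1 + z) \<or> w dvd (4 - z) - (1 - z) \<or> w dvd (9 + z) - (4 + z)
        \<or> w dvd (9 - z) - (4 - z) \<or> w dvd (9 + z) - (1 + z) \<or> w dvd (9 - z) - (1 - z)"
      using dvd_diff by blast
    then show False
      using w(2) w3 w8 by simp
  qed
  then obtain u where u: "u \<in> {1,2,3}" "\<not> w dvd u\<^sup>2 + z" "\<not> w dvd u\<^sup>2 - z"
    by blast
  then have "coprime u M"
    using c2 c3 by auto
  then obtain x y where xy: "M dvd x\<^sup>2 + y\<^sup>2 - z" "M dvd 2 * u * x - (u\<^sup>2 + z)"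
    "M dvd 2 * u * y - i * (u\<^sup>2 - z)"
    using sum_two_squares_via_sqrt_minus_one[OF M(1,2)] by blast
  have "\<not> w dvd x"
  proof
    assume "w dvd x"
    then have "w dvd 2 * u * x" by simp
    then show False
      using xy(2) w(1) u(2) by (meson dvd_trans dvd_diff_right_iff)
  qed
  moreover have "\<not> w dvd y"
  proof
    assume "w dvd y"
    then have "w dvd 2 * u * y" by simp
    then have "w dvd i * (u\<^sup>2 - z)"
      using xy(3) w(1) by (meson dvd_trans dvd_diff_right_iff)
    moreover have "coprime w i"
      using coprime_divisors[OF w(1) dvd_refl] coprime_of_dvd_square_plus_one[OF M(1)] by blast
    ultimately show False
      using u(3) by (simp add: coprime_dvd_mult_right_iff)
  qed
  ultimately show thesis
    using that xy(1) by blast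
qed

section \<open>Representations modulo primes and their combination\<close>

text \<open>Pigeonhole: for odd \<open>q\<close> the residues \<open>a^2\<close> and the residues
  \<open>z - b^2\<close> each number \<open>(q + 1) / 2\<close>, so the two sets meet.\<close>

lemma sum_two_squares_mod_prime:
  fixes q z :: int
  assumes "prime q"
  obtains x y where "q dvd x\<^sup>2 + y\<^sup>2 - z"
proof (cases "q = 2")
  case True
  \<comment> \<open>Modulo 2, \<open>z\<close> is its own square.\<close>
  have "2 dvd z\<^sup>2 + 0\<^sup>2 - z"
    by simp
  then show thesis
    using that True by blast
next
  case False
  have "odd q" "q > 1"
    using assms False by (metis prime_odd_int prime_gt_1_int order_le_less zless_imp_add1_zle one_add_one)
     (simp add: assms prime_gt_1_int)
  \<comment> \<open>One representative from each pair \<open>a\<close>, \<open>-a\<close> modulo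
    \<open>q\<close>, with 0 included.\<close>
  define S where "S = {0..q div 2}"
  have inj: "a = b" if "a \<in> S" "b \<in> S" "q dvd a\<^sup>2 - b\<^sup>2" for a b
  proof -
    have "q dvd (a - b) * (a + b)"
      using that(3) by (simp add: power2_eq_square algebra_simps)
    then have "q dvd a - b \<or> q dvd a + b"
      using assms prime_dvd_mult_iff by blast
    then show ?thesis
    proof
      assume "q dvd a - b"
      moreover have "\<bar>a - b\<bar> < \<bar>q\<bar>"
        using that \<open>q > 1\<close> by (auto simp: S_def)
      ultimately show ?thesis
        using dvd_imp_le_int[of "a - b" q] by linarith
    next
      assume "q dvd a + b"
      \<comment> \<open>For odd \<open>q\<close>, \<open>a + b\<close> is at most
        \<open>q - 1\<close>; so it is 0, and both \<open>a\<close> and \<open>b\<close>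
        vanish.\<close>
      moreover have "\<bar>a + b\<bar> < \<bar>q\<bar>" "0 \<le> a" "0 \<le> b"
        using that(1,2) \<open>q > 1\<close> \<open>odd q\<close> unfolding S_def atLeastAtMost_iff by presburger+
      ultimately show ?thesis
        using dvd_imp_le_int[of "a + b" q] by linarith
    qed
  qed
  define f where "f a = a\<^sup>2 mod q" for a
  define g where "g b = (z - b\<^sup>2) mod q" for b
  have "inj_on f S" "inj_on g S"
    using inj by (auto intro!: inj_onI simp: f_def g_def mod_eq_dvd_iff)
     (metis minus_diff_eq dvd_minus_iff)
  then have "card (f ` S) = card S" "card (g ` S) = card S"
    by (simp_all add: card_image)
  moreover have "f ` S \<union> g ` S \<subseteq> {0..<q}"
    using \<open>q > 1\<close> by (auto simp: f_def g_def)
  then have "card (f ` S \<union> g ` S) \<le> nat q"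
    using card_mono[of "{0..<q}"] by simp
  moreover have "2 * card S > nat q"
    using \<open>q > 1\<close> \<open>odd q\<close> unfolding S_def by simp
  moreover have "finite S"
    by (simp add: S_def)
  ultimately have "f ` S \<inter> g ` S \<noteq> {}"
    using card_Un_disjoint[of "f ` S" "g ` S"] by auto
  then obtain a b where "f a = g b"
    by auto
  then have "q dvd a\<^sup>2 + b\<^sup>2 - z"
    by (simp add: f_def g_def mod_eq_dvd_iff algebra_simps)
  then show thesis
    by (rule that)
qed

text \<open>The congruences to the given solutions are kept in the conclusion because they carry
  nondivisibility over to the combined solution.\<close>

lemma sum_two_squares_chinese:
  fixes M m z :: int
  assumes "coprime M m" "M dvd x1\<^sup>2 + y1\<^sup>2 - z" "m dvd x2\<^sup>2 + y2\<^sup>2 - z"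
  obtains x y where "M * m dvd x\<^sup>2 + y\<^sup>2 - z" "M dvd x - x1" "M dvd y - y1"
    "m dvd x - x2" "m dvd y - y2"
proof -
  obtain x where x: "[x = x1] (mod M)" "[x = x2] (mod m)"
    using binary_chinese_remainder_int[OF assms(1)] by blast
  obtain y where y: "[y = y1] (mod M)" "[y = y2] (mod m)"
    using binary_chinese_remainder_int[OF assms(1)] by blast
  have "[x\<^sup>2 + y\<^sup>2 = x1\<^sup>2 + y1\<^sup>2] (mod M)" "[x\<^sup>2 + y\<^sup>2 = x2\<^sup>2 + y2\<^sup>2] (mod m)"
    using x y by (intro cong_add cong_pow; simp)+
  moreover have "[x1\<^sup>2 + y1\<^sup>2 = z] (mod M)" "[x2\<^sup>2 + y2\<^sup>2 = z] (mod m)"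
    using assms(2,3) by (simp_all add: cong_iff_dvd_diff)
  ultimately have "[x\<^sup>2 + y\<^sup>2 = z] (mod M * m)"
    using assms(1) by (meson cong_trans coprime_cong_mult)
  then show thesis
    using x y that by (simp add: cong_iff_dvd_diff)
qed

text \<open>Induction splitting off a full prime power \<open>p ^ j\<close>. For \<open>p\<close>
  congruent to 1 (mod 4) a square root of -1 handles every exponent; otherwise \<open>j = 1\<close>
  and the pigeonhole argument applies.\<close>

lemma sum_two_squares_mod:
  fixes m z :: int
  assumes "m > 0" "\<And>q. prime q \<Longrightarrow> \<not> [q = 1] (mod 4) \<Longrightarrow> \<not> q\<^sup>2 dvd m"
  shows "\<exists>x y. m dvd x\<^sup>2 + y\<^sup>2 - z"
  using assms
proof (induction "nat m" arbitrary: m rule: less_induct)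
  case less
  show ?case
  proof (cases "m = 1")
    case False
    then obtain p :: int where p: "prime p" "p dvd m"
      using less.prems(1) prime_divisor_exists[of m] by auto
    define j where "j = multiplicity p m"
    obtain m' where m': "m = p ^ j * m'" "\<not> p dvd m'"
      unfolding j_def using multiplicity_decompose'[of m p] p(1) less.prems(1) not_prime_unit
      by (metis less_irrefl)
    have "j > 0"
      using m' p(2) by (cases j) auto
    have "p > 1"
      using p(1) prime_gt_1_int by blast
    then have "p ^ j > 1"
      using \<open>j > 0\<close> by simp
    then have "m' > 0"
      using less.prems(1) m'(1) by (metis zero_less_mult_pos less_trans zero_less_one)
    then have "m' < m"
      using \<open>p ^ j > 1\<close> m'(1) by simp
    then have "\<exists>x y. m' dvd x\<^sup>2 + y\<^sup>2 - z"
      using less.hyps[of m'] less.prems \<open>m' > 0\<close> unfolding m'(1) by (meson dvd_mult nat_mono_iff)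
    then obtain x2 y2 where 2: "m' dvd x2\<^sup>2 + y2\<^sup>2 - z"
      by blast
    have "\<exists>x y. p ^ j dvd x\<^sup>2 + y\<^sup>2 - z"
    proof (cases "[p = 1] (mod 4)")
      case True
      then obtain i where "p ^ j dvd i\<^sup>2 + 1"
        using sqrt_minus_one_mod_prime_power[OF p(1)] by blast
      moreover have "odd p"
        using True by (auto simp: cong_def) presburger
      then have "odd (p ^ j)"
        by simp
      ultimately show ?thesis
        using sum_two_squares_via_sqrt_minus_one[of "p ^ j" i 1] by (metis coprime_1_left)
    next
      case False
      then have "\<not> p\<^sup>2 dvd m"
        using less.prems p(1) by blast
      then have "j < 2"
        unfolding m'(1) by (metis le_imp_power_dvd dvd_mult2 not_less)
      then have "j = 1"
        using \<open>j > 0\<close> by simp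
      then show ?thesis
        using sum_two_squares_mod_prime[OF p(1)] by (metis power_one_right)
    qed
    then obtain x1 y1 where 1: "p ^ j dvd x1\<^sup>2 + y1\<^sup>2 - z"
      by blast
    have "coprime (p ^ j) m'"
      using p(1) m'(2) by (simp add: prime_imp_coprime)
    then show ?thesis
      using sum_two_squares_chinese[OF _ 1 2] m'(1) by metis
  qed simp
qed

section \<open>Keeping the squares nonzero at a prime 1 (mod 4)\<close>

text \<open>Nonvanishing is arranged modulo \<open>p ^ k\<close> alone; \<open>m\<close> contributes
  any representation of \<open>z\<close>, glued on without disturbing it.\<close>

lemma sum_two_squares_mod_prime_power_mult:
  fixes p m z :: int
  assumes p: "prime p" "[p = 1] (mod 4)" "\<not> p dvd m"
    and m: "m > 0" "\<And>q. prime q \<Longrightarrow> \<not> [q = 1] (mod 4) \<Longrightarrow> \<not> q\<^sup>2 dvd m"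
    and 1: "p ^ k dvd x1\<^sup>2 + y1\<^sup>2 - z"
  obtains x y where "p ^ k * m dvd x\<^sup>2 + y\<^sup>2 - z" "p ^ k dvd x - x1" "p ^ k dvd y - y1"
proof -
  obtain x2 y2 where "m dvd x2\<^sup>2 + y2\<^sup>2 - z"
    using sum_two_squares_mod[OF m] by blast
  moreover have "coprime (p ^ k) m"
    using p by (simp add: prime_imp_coprime)
  ultimately show thesis
    using sum_two_squares_chinese 1 that by metis
qed

text \<open>A prime 1 (mod 4) is neither 2 nor 3, so \<open>sum_two_squares_both_nonzero\<close>
  applies to \<open>p ^ k\<close>. The parameter \<open>w\<close> allows 25 in place of 5 when
  \<open>p = 5\<close>.\<close>

lemma both_nonzero_mod_prime_power_mult:
  fixes p m w z :: int
  assumes p: "prime p" "[p = 1] (mod 4)" "\<not> p dvd m"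
    and m: "m > 0" "\<And>q. prime q \<Longrightarrow> \<not> [q = 1] (mod 4) \<Longrightarrow> \<not> q\<^sup>2 dvd m"
    and w: "w dvd p ^ k" "\<not> w dvd 5"
  obtains x y where "p ^ k * m dvd x\<^sup>2 + y\<^sup>2 - z" "\<not> w dvd x" "\<not> w dvd y"
proof -
  obtain i where i: "p ^ k dvd i\<^sup>2 + 1"
    using sqrt_minus_one_mod_prime_power[OF p(1,2)] by blast
  have "\<not> 2 dvd p ^ k"
    using p(1,2) by (auto simp: cong_def prime_dvd_power_iff) presburger
  moreover have "\<not> 3 dvd p ^ k"
  proof
    assume "3 dvd p ^ k"
    then have "3 dvd p"
      by (rule prime_dvd_power[rotated]) simp
    then have "p = 3"
      using p(1) by (metis prime_int_iff zero_le_numeral numeral_eq_one_iff num.distinct(3))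
    then show False
      using p(2) by (simp add: cong_def)
  qed
  ultimately obtain x1 y1 where 1: "p ^ k dvd x1\<^sup>2 + y1\<^sup>2 - z" "\<not> w dvd x1" "\<not> w dvd y1"
    using sum_two_squares_both_nonzero[OF i _ _ w] by blast
  obtain x y where "p ^ k * m dvd x\<^sup>2 + y\<^sup>2 - z" "p ^ k dvd x - x1" "p ^ k dvd y - y1"
    using sum_two_squares_mod_prime_power_mult[OF p m 1(1)] by blast
  moreover from this have "\<not> w dvd x" "\<not> w dvd y"
    using 1(2,3) w(1) by (meson dvd_diff_right_iff dvd_trans)+
  ultimately show thesis
    using that by blast
qed

text \<open>
  For even \<open>n\<close>, a summand that is odd is automatically nonzero modulo \<open>n\<close>. One can choose the first
  summand odd, so only the second one has to be kept away from \<open>0\<close> modulo \<open>p\<close>.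
\<close>

lemma both_squares_nonzero_even:
  fixes p m z :: int
  assumes p: "prime p" "[p = 1] (mod 4)" "\<not> p dvd m"
    and m: "m > 0" "\<And>q. prime q \<Longrightarrow> \<not> [q = 1] (mod 4) \<Longrightarrow> \<not> q\<^sup>2 dvd m"
    and "k > 0" "odd m"
  obtains x y where "p ^ k * m * 2 dvd x\<^sup>2 + y\<^sup>2 - z" "\<not> p ^ k * m * 2 dvd x\<^sup>2"
    "\<not> p ^ k * m * 2 dvd y\<^sup>2"
proof -
  obtain i where i: "p ^ k dvd i\<^sup>2 + 1"
    using sqrt_minus_one_mod_prime_power[OF p(1,2)] by blast
  have "odd p"
    using p(2) unfolding cong_def by presburger
  have pk: "p dvd p ^ k"
    using \<open>k > 0\<close> by simp
  obtain x1 y1 where 1: "p ^ k dvd x1\<^sup>2 + y1\<^sup>2 - z" "\<not> p dvd y1"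
    using sum_two_squares_second_nonzero[OF i _ pk] \<open>odd p\<close> p(1) not_prime_unit by (metis even_power)
  obtain x2 y2 where 2: "p ^ k * m dvd x2\<^sup>2 + y2\<^sup>2 - z" "p ^ k dvd y2 - y1"
    using sum_two_squares_mod_prime_power_mult[OF p m 1(1)] by blast
  \<comment> \<open>The parity that makes \<open>1 + e^2\<close> congruent to \<open>z\<close>
    modulo 2, so that the first coordinate can be odd.\<close>
  define e where "e = (z + 1) mod 2"
  have "2 dvd 1\<^sup>2 + e\<^sup>2 - z"
    unfolding e_def by (cases "even z") (auto elim!: evenE oddE)
  moreover have "coprime (p ^ k * m) 2"
    using \<open>odd p\<close> \<open>odd m\<close> by simp
  ultimately obtain x y where xy: "p ^ k * m * 2 dvd x\<^sup>2 + y\<^sup>2 - z" "p ^ k * m dvd y - y2" "2 dvd x - 1"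
    using sum_two_squares_chinese 2(1) by metis
  have "\<not> p ^ k * m * 2 dvd x\<^sup>2"
    using xy(3) by (auto dest: dvd_mult_right)
  moreover have "\<not> p dvd y"
    using 1(2) 2(2) xy(2) pk by (meson dvd_diff_right_iff dvd_trans dvd_mult_left)
  then have "\<not> p ^ k * m * 2 dvd y\<^sup>2"
    using pk p(1) by (meson dvd_trans dvd_mult_left prime_dvd_power)
  ultimately show thesis
    using that xy(1) by blast
qed

section \<open>Reformulation by divisibility\<close>

lemma ex_nontrivial_solution_iff:
  "(\<exists>s. nontrivial_solution n z s) \<longleftrightarrow>
    (\<exists>x y. n dvd x\<^sup>2 + y\<^sup>2 - z \<and> \<not> n dvd x\<^sup>2 \<and> \<not> n dvd y\<^sup>2)"
  by (auto simp: nontrivial_solution_def cong_iff_dvd_diff)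

lemma all_residues_nontrivial_solution_iff:
  assumes "n \<ge> 2"
  shows "(\<forall>z \<in> carrier (residue_ring n). \<exists>s. nontrivial_solution n z s) \<longleftrightarrow>
    (\<forall>z. \<exists>x y. n dvd x\<^sup>2 + y\<^sup>2 - z \<and> \<not> n dvd x\<^sup>2 \<and> \<not> n dvd y\<^sup>2)"
proof -
  have "n dvd a - z mod n \<longleftrightarrow> n dvd a - z" for a z
    by (simp add: mod_eq_dvd_iff[symmetric])
  moreover have "z mod n \<in> carrier (residue_ring n)" for z
    using assms by (simp add: residue_ring_def)
  ultimately show ?thesis
    unfolding ex_nontrivial_solution_iff by metis
qed

section \<open>Necessity of the four conditions\<close>

context
  fixes n :: int
  assumes n: "n \<ge> 2"
    and solvable: "\<And>z. \<exists>x y. n dvd x\<^sup>2 + y\<^sup>2 - z \<and> \<not> n dvd x\<^sup>2 \<and> \<not> n dvd y\<^sup>2"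
begin

text \<open>Test \<open>z = q\<close>: \<open>q\<close> divides both \<open>x\<close> and
  \<open>y\<close>, so \<open>q^2\<close> would divide \<open>q\<close>.\<close>

lemma prime_3_mod_4_square_not_dvd:
  assumes q: "prime q" "[q = 3] (mod 4)"
  shows "\<not> q\<^sup>2 dvd n"
proof
  assume *: "q\<^sup>2 dvd n"
  obtain x y where "n dvd x\<^sup>2 + y\<^sup>2 - q"
    using solvable by blast
  then have xy: "q\<^sup>2 dvd x\<^sup>2 + y\<^sup>2 - q"
    using * dvd_trans by blast
  then have "q dvd x\<^sup>2 + y\<^sup>2 - q"
    by (metis dvd_mult_left power2_eq_square)
  then have "q dvd x\<^sup>2 + y\<^sup>2"
    by (metis dvd_diff_left_iff dvd_refl)
  then have "q dvd x" "q dvd y"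
    using prime_dvd_of_dvd_sum_squares[OF q, of x y] prime_dvd_of_dvd_sum_squares[OF q, of y x]
    by (simp_all add: add.commute)
  then have "q\<^sup>2 dvd x\<^sup>2 + y\<^sup>2"
    by simp
  then have "q\<^sup>2 dvd q"
    using xy by (metis dvd_diff_right_iff)
  then have "q * q dvd q * 1"
    by (simp add: power2_eq_square)
  then show False
    using q(1) not_prime_unit dvd_mult_cancel_left by (metis not_prime_0)
qed

text \<open>Test \<open>z = 3\<close>: squares are 0 or 1 modulo 4, so two of them never add up to
  3.\<close>

lemma four_not_dvd: "\<not> 4 dvd n"
proof
  assume *: "4 dvd n"
  obtain x y where "n dvd x\<^sup>2 + y\<^sup>2 - 3"
    using solvable by blast
  then have "4 dvd x\<^sup>2 + y\<^sup>2 - 3"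
    using * dvd_trans by blast
  moreover have "a\<^sup>2 mod 4 = 0 \<or> a\<^sup>2 mod 4 = 1" for a :: int
  proof (cases "even a")
    case False
    then obtain b where "a = 2 * b + 1"
      by (rule oddE)
    then have "a\<^sup>2 = 1 + (b\<^sup>2 + b) * 4"
      by (simp add: power2_eq_square algebra_simps)
    then show ?thesis
      by (simp only: mod_mult_self1) simp
  qed (auto simp: power2_eq_square)
  from this[of x] this[of y] have "(x\<^sup>2 + y\<^sup>2) mod 4 \<noteq> 3"
    by presburger
  ultimately show False
    by presburger
qed

text \<open>All primes in \<open>d\<close> are 3 (mod 4), and
  \<open>prime_3_mod_4_square_not_dvd\<close> makes \<open>d\<close> squarefree.\<close>

lemma dvd_of_only_primes_3_mod_4:
  assumes "d dvd n" "odd d" "d dvd x\<^sup>2 + y\<^sup>2"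
    and "\<And>p. prime p \<Longrightarrow> [p = 1] (mod 4) \<Longrightarrow> \<not> p dvd d"
  shows "d dvd x"
proof (rule dvd_of_dvd_sum_squares[of d x y])
  show "d \<noteq> 0"
    using assms(1) n by auto
next
  fix q
  assume q: "prime q" "q dvd d"
  then have "[q = 3] (mod 4)"
    using assms(2,4) prime_int_cong_1_or_3 by blast
  then show "[q = 3] (mod 4) \<and> \<not> q\<^sup>2 dvd d"
    using prime_3_mod_4_square_not_dvd q(1) assms(1) dvd_trans by blast
qed fact

text \<open>Otherwise the odd part \<open>h\<close>, used as \<open>z\<close>, divides both
  \<open>x\<close> and \<open>y\<close>. If \<open>n = 2 * h\<close>, the sum is odd, so one
  coordinate is even and hence divisible by \<open>n\<close>; its square vanishes modulo
  \<open>n\<close>.\<close>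

lemma ex_prime_1_mod_4_dvd: "\<exists>p. prime p \<and> [p = 1] (mod 4) \<and> p dvd n"
proof (rule ccontr)
  assume no: "\<not> ?thesis"
  define h where "h = (if even n then n div 2 else n)"
  have h: "h dvd n" "odd h"
    using four_not_dvd unfolding h_def by auto presburger+
  obtain x y where xy: "n dvd x\<^sup>2 + y\<^sup>2 - h" "\<not> n dvd x\<^sup>2" "\<not> n dvd y\<^sup>2"
    using solvable by blast
  then have "h dvd x\<^sup>2 + y\<^sup>2 - h"
    using h(1) dvd_trans by blast
  then have "h dvd x\<^sup>2 + y\<^sup>2"
    by (metis dvd_diff_left_iff dvd_refl)
  then have hxy: "h dvd x" "h dvd y"
    using dvd_of_only_primes_3_mod_4[OF h, of x y] dvd_of_only_primes_3_mod_4[OF h, of y x]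
      no h(1) dvd_trans by (auto simp: add.commute)
  have "n dvd x \<or> n dvd y"
  proof (cases "even n")
    case True
    then have n2: "n = h * 2"
      by (simp add: h_def)
    then have "2 dvd x\<^sup>2 + y\<^sup>2 - h"
      using xy(1) by (metis dvd_mult_right)
    then have "even x \<or> even y"
      using h(2) by auto
    moreover have "coprime h 2"
      using h(2) by simp
    ultimately show ?thesis
      unfolding n2 using hxy divides_mult by blast
  next
    case False
    then show ?thesis
      using hxy by (simp add: h_def)
  qed
  then show False
    using xy(2,3) by (auto simp: power2_eq_square)
qed

text \<open>If \<open>m\<close> has no prime 1 (mod 4), then \<open>z\<close> divisible by
  \<open>m\<close> puts \<open>m\<close> into both coordinates, and \<open>z\<close> congruent to 1
  modulo 5 puts 5 into one of them. The square of that one is divisible by \<open>n\<close>.\<close>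

lemma five_power_dichotomy:
  assumes "odd n" "n = 5 ^ k * m" "\<not> 5 dvd m" "k < 3"
  shows "\<exists>p. prime p \<and> [p = 1] (mod 4) \<and> p dvd m"
proof (rule ccontr)
  assume no: "\<not> ?thesis"
  have "prime (5::int)"
    by simp
  then have "coprime 5 m"
    using assms(3) prime_imp_coprime by blast
  then obtain z where z: "[z = 1] (mod 5)" "[z = 0] (mod m)"
    using binary_chinese_remainder_int by blast
  \<comment> \<open>Here \<open>k < 3\<close> enters: \<open>a^2\<close> is divisible by
    \<open>25 * m\<close>, a multiple of \<open>n\<close>.\<close>
  have main: "n dvd a\<^sup>2" if "5 dvd a" "m dvd a" for a
  proof -
    have "coprime (5\<^sup>2) m"
      using \<open>coprime 5 m\<close> by (subst coprime_power_left_iff) simp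
    moreover have "5\<^sup>2 dvd a\<^sup>2" "m dvd a\<^sup>2"
      using that dvd_power_same[of 5 a 2] by (auto simp: power2_eq_square)
    ultimately have "5\<^sup>2 * m dvd a\<^sup>2"
      by (rule divides_mult[rotated 2])
    moreover have "n dvd 5\<^sup>2 * m"
      unfolding assms(2) using \<open>k < 3\<close> by (intro mult_dvd_mono le_imp_power_dvd) auto
    ultimately show ?thesis
      by (rule dvd_trans[rotated])
  qed
  obtain x y where xy: "n dvd x\<^sup>2 + y\<^sup>2 - z" "\<not> n dvd x\<^sup>2" "\<not> n dvd y\<^sup>2"
    using solvable by blast
  have m: "m dvd n" "odd m"
    using assms(1,2) by auto
  have "m dvd x\<^sup>2 + y\<^sup>2 - z"
    using xy(1) m(1) dvd_trans by blast
  moreover have "m dvd z"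
    using z(2) by (simp add: cong_0_iff)
  ultimately have "m dvd x\<^sup>2 + y\<^sup>2"
    by (metis dvd_diff_left_iff)
  then have mxy: "m dvd x" "m dvd y"
    using dvd_of_only_primes_3_mod_4[OF m, of x y] dvd_of_only_primes_3_mod_4[OF m, of y x] no
    by (auto simp: add.commute)
  \<comment> \<open>For \<open>k = 0\<close> one has \<open>n = m\<close>, which does have a prime
    factor 1 (mod 4).\<close>
  have "k \<noteq> 0"
    using no ex_prime_1_mod_4_dvd assms(2) by (metis mult_1 power_0)
  then have "5 dvd n"
    using assms(2) by simp
  then have "[x\<^sup>2 + y\<^sup>2 = z] (mod 5)"
    using xy(1) dvd_trans by (auto simp: cong_iff_dvd_diff)
  then have "(x\<^sup>2 + y\<^sup>2) mod 5 = 1"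
    using z(1) by (simp add: cong_def)
  moreover have "a\<^sup>2 mod 5 = 1 \<or> a\<^sup>2 mod 5 = 4" if "\<not> 5 dvd a" for a :: int
  proof -
    have "a mod 5 \<in> {1, 2, 3, 4}"
      using that by (simp, presburger)
    moreover have "a\<^sup>2 mod 5 = (a mod 5)\<^sup>2 mod 5"
      by (simp add: power_mod)
    ultimately show ?thesis
      by auto
  qed
  \<comment> \<open>Sums of two residues from 1 and 4 are 2, 0 or 3 modulo 5, never 1.\<close>
  from this[of x] this[of y] have "5 dvd x \<or> 5 dvd y \<or> (x\<^sup>2 + y\<^sup>2) mod 5 \<in> {0, 2, 3}"
    by (simp, presburger)
  ultimately have "5 dvd x \<or> 5 dvd y"
    by auto
  then show False
    using main mxy xy(2,3) by blast
qed

end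

section \<open>Sufficiency of the four conditions\<close>

text \<open>It is enough that \<open>w\<close> divides neither coordinate, for a \<open>w\<close>
  dividing every \<open>a\<close> whose square is divisible by \<open>p ^ k * m\<close>. In general
  \<open>w = p\<close> works; \<open>w\<close> must not divide 5, so for \<open>p = 5\<close> it is
  25, where \<open>k \<ge> 3\<close> turns \<open>5 ^ 3 dvd a^2\<close> into
  \<open>25 dvd a\<close>.\<close>

lemma both_squares_nonzero_odd:
  fixes n z p m :: int
  assumes p: "prime p" "[p = 1] (mod 4)" "\<not> p dvd m"
    and m: "m > 0" "\<And>q. prime q \<Longrightarrow> \<not> [q = 1] (mod 4) \<Longrightarrow> \<not> q\<^sup>2 dvd m"
    and k: "k > 0" "p = 5 \<Longrightarrow> k \<ge> 3"
  obtains x y where "p ^ k * m dvd x\<^sup>2 + y\<^sup>2 - z" "\<not> p ^ k * m dvd x\<^sup>2" "\<not> p ^ k * m dvd y\<^sup>2"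
proof -
  define w where "w = (if p = 5 then p\<^sup>2 else p)"
  have "w dvd p ^ k"
    using le_imp_power_dvd[of 2 k p] k by (auto simp: w_def)
  moreover have "\<not> w dvd 5"
    unfolding w_def using p(1) primes_dvd_imp_eq[of p 5] by auto
  ultimately obtain x y where xy: "p ^ k * m dvd x\<^sup>2 + y\<^sup>2 - z" "\<not> w dvd x" "\<not> w dvd y"
    using both_nonzero_mod_prime_power_mult[OF p m] by blast
  have w: "w dvd a" if a: "p ^ k * m dvd a\<^sup>2" for a
  proof -
    have pk: "p ^ k dvd a\<^sup>2"
      using a by (rule dvd_mult_left)
    then have "p dvd a"
      using p(1) k(1) by (meson dvd_power dvd_trans prime_dvd_power)
    then obtain b where b: "a = p * b"
      by blast
    show ?thesis
    proof (cases "p = 5")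
      case True
      then have "p ^ 3 dvd a\<^sup>2"
        using k(2) pk by (meson dvd_trans le_imp_power_dvd)
      then have "p\<^sup>2 * p dvd p\<^sup>2 * b\<^sup>2"
        by (simp add: b power_mult_distrib power3_eq_cube power2_eq_square)
      then have "p dvd b\<^sup>2"
        unfolding dvd_mult_cancel_left using True by simp
      then have "p dvd b"
        using p(1) prime_dvd_power by blast
      then show ?thesis
        using True by (auto simp: w_def b power2_eq_square)
    next
      case False
      then show ?thesis
        using \<open>p dvd a\<close> by (simp add: w_def)
    qed
  qed
  show thesis
    using that[OF xy(1)] w xy(2,3) by blast
qed

lemma nontrivial_solutions_exist:
  fixes n z :: int
  assumes n: "n > 0"
    and 1: "\<And>q. prime q \<Longrightarrow> [q = 3] (mod 4) \<Longrightarrow> \<not> q\<^sup>2 dvd n"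
    and 2: "\<not> 4 dvd n"
    and 3: "prime p" "[p = 1] (mod 4)" "p dvd n"
    and 4: "odd n \<Longrightarrow> p = 5 \<Longrightarrow> 5 ^ 3 dvd n"
  shows "\<exists>x y. n dvd x\<^sup>2 + y\<^sup>2 - z \<and> \<not> n dvd x\<^sup>2 \<and> \<not> n dvd y\<^sup>2"
proof -
  \<comment> \<open>The primes not congruent to 1 (mod 4) are 2 and those congruent to 3, so this
    merges the first two conditions.\<close>
  have sq: "\<not> q\<^sup>2 dvd n" if "prime q" "\<not> [q = 1] (mod 4)" for q :: int
    using 1[OF that(1)] prime_int_cong_1_or_3[OF that(1)] that(2) 2 by (cases "q = 2") auto
  define k where "k = multiplicity p n"
  obtain m where m: "n = p ^ k * m" "\<not> p dvd m"
    unfolding k_def using multiplicity_decompose'[of n p] 3(1) n not_prime_unit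
    by (metis less_irrefl)
  have "k > 0"
    using m 3(3) by (cases k) auto
  have "p > 1"
    using 3(1) prime_gt_1_int by blast
  then have "p ^ k > 0"
    by simp
  then have "m > 0"
    using n m(1) by (metis zero_less_mult_pos)
  show ?thesis
  proof (cases "even n")
    case True
    have "odd p"
      using 3(2) unfolding cong_def by presburger
    then have "even m"
      using True m(1) by simp
    then obtain h where h: "m = h * 2"
      by (metis dvd_def mult.commute)
    have n': "n = p ^ k * h * 2"
      by (simp add: m(1) h)
    \<comment> \<open>An even \<open>h\<close> would make 4 divide \<open>n\<close>.\<close>
    have "odd h"
      using 2 unfolding n' by auto
    moreover have "\<not> p dvd h" "h > 0"
      using m(2) \<open>m > 0\<close> h by auto
    moreover have "\<not> q\<^sup>2 dvd h" if "prime q" "\<not> [q = 1] (mod 4)" for q :: int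
      using sq[OF that] unfolding n' by (meson dvd_mult dvd_mult2)
    ultimately show ?thesis
      unfolding n' using both_squares_nonzero_even[OF 3(1,2) _ _ _ \<open>k > 0\<close>] by metis
  next
    case False
    have "k \<ge> 3" if "p = 5"
      unfolding k_def using 4[OF False that] that n by (intro multiplicity_geI) auto
    moreover have "\<not> q\<^sup>2 dvd m" if "prime q" "\<not> [q = 1] (mod 4)" for q :: int
      using sq[OF that] unfolding m(1) by (meson dvd_mult)
    ultimately show ?thesis
      unfolding m(1) using both_squares_nonzero_odd[OF 3(1,2) m(2) \<open>m > 0\<close> _ \<open>k > 0\<close>] by metis
  qed
qed

theorem theorem3p2:
  fixes n :: int
  assumes "n \<ge> 2"
  shows "(\<forall>z \<in> carrier (residue_ring n). \<exists>s. nontrivial_solution n z s) \<longleftrightarrow>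
    ((\<forall>q::int. prime q \<and> [q = 3] (mod 4) \<and> [n = 0] (mod q) \<longrightarrow> \<not> [n = 0] (mod q\<^sup>2)) \<and>
     \<not> [n = 0] (mod 4) \<and>
     (\<exists>p::int. prime p \<and> [p = 1] (mod 4) \<and> [n = 0] (mod p)) \<and>
     ([n = 1] (mod 2) \<longrightarrow>
        (\<forall>(k::nat) (m::int). n = 5 ^ k * m \<and> \<not> [m = 0] (mod 5) \<longrightarrow>
           k \<ge> 3 \<or>
           (k < 3 \<and> (\<exists>p::int. prime p \<and> [p = 1] (mod 4) \<and> [m = 0] (mod p))))))"
  (is "?A \<longleftrightarrow> ?B")
proof
  assume ?A
  then have solvable: "\<exists>x y. n dvd x\<^sup>2 + y\<^sup>2 - z \<and> \<not> n dvd x\<^sup>2 \<and> \<not> n dvd y\<^sup>2" for z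
    using all_residues_nontrivial_solution_iff[OF assms] by blast
  have "odd n" if "[n = 1] (mod 2)"
    using that by (simp add: cong_def odd_iff_mod_2_eq_one)
  then have "k \<ge> 3 \<or> k < 3 \<and> (\<exists>p. prime p \<and> [p = 1] (mod 4) \<and> p dvd m)"
    if "[n = 1] (mod 2)" "n = 5 ^ k * m" "\<not> 5 dvd m" for k m
    using five_power_dichotomy[OF assms solvable _ that(2,3)] that(1) not_less by blast
  then show ?B
    unfolding cong_0_iff
    using prime_3_mod_4_square_not_dvd[OF assms solvable] four_not_dvd[OF assms solvable]
      ex_prime_1_mod_4_dvd[OF assms solvable]
    by blast
next
  assume B: ?B
  then have 1: "\<not> q\<^sup>2 dvd n" if "prime q" "[q = 3] (mod 4)" for q
    using that dvd_trans[of q "q\<^sup>2" n] unfolding cong_0_iff by auto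
  have 2: "\<not> 4 dvd n"
    using B by (simp add: cong_0_iff)
  \<comment> \<open>The prime is chosen to suit \<open>nontrivial_solutions_exist\<close>: for odd
    \<open>n\<close> it is 5 if \<open>k \<ge> 3\<close>, and otherwise a prime factor of
    \<open>m\<close>, which differs from 5.\<close>
  have "\<exists>p. prime p \<and> [p = 1] (mod 4) \<and> p dvd n \<and> (odd n \<longrightarrow> p = 5 \<longrightarrow> 5 ^ 3 dvd n)"
  proof (cases "odd n")
    case True
    define k where "k = multiplicity 5 n"
    obtain m where m: "n = 5 ^ k * m" "\<not> 5 dvd m"
      unfolding k_def using multiplicity_decompose'[of n 5] assms by auto
    have "[n = 1] (mod 2)"
      using True by (simp add: cong_def odd_iff_mod_2_eq_one)
    then consider "k \<ge> 3" | p where "prime p" "[p = 1] (mod 4)" "p dvd m"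
      using B m unfolding cong_0_iff by blast
    then show ?thesis
    proof cases
      case 1
      then have "5 ^ 3 dvd n"
        unfolding m(1) by (intro dvd_mult2 le_imp_power_dvd)
      moreover from this have "5 dvd n"
        by (rule dvd_trans[rotated]) simp
      moreover have "prime (5::int)" "[5 = 1] (mod (4::int))"
        by (simp_all add: cong_def)
      ultimately show ?thesis
        by blast
    next
      case (2 p)
      then have "p \<noteq> 5" "p dvd n"
        using m by auto
      with 2 show ?thesis
        by blast
    qed
  next
    case False
    then show ?thesis
      using B by (auto simp: cong_0_iff)
  qed
  then have "\<exists>x y. n dvd x\<^sup>2 + y\<^sup>2 - z \<and> \<not> n dvd x\<^sup>2 \<and> \<not> n dvd y\<^sup>2" for z
    using nontrivial_solutions_exist[OF _ 1 2] assms by fastforce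
  then show ?A
    using all_residues_nontrivial_solution_iff[OF assms] by blast
qed

end
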